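(* Let $D$ be a distributive lattice with $0$ and suppose that there exists a surjective lattice homomorphism $f\colon\operatorname{Csc}G\to D$ for some $\ell$-group $G$. If $D$ is finitely separable, then $D$ is monotone-Cevian.
   Context: For an $\ell$-group $G$ and $a\in G$, $\langle a\rangle=\{x\in G: -n|a|\leq x\leq n|a|\text{ for some }n\in\omega\}$, $|a|=a\vee(-a)$, is the convex $\ell$-subgroup generated by $a$; $\operatorname{Csc}G$ denotes the lattice of all such $\langle a\rangle$ under inclusion. A poset is finitely separable if there are functions $A,B$ on it such that each $A(z)$ is a finite set of upper bounds of $z$, each $B(z)$ a finite set of lower bounds of $z$, and $x\leq y$ implies $A(x)\cap B(y)\neq\varnothing$. A deviation on $D$ is a binary operation $\smallsetminus$ with $x\leq y\vee(x\smallsetminus y)$ and $(x\smallsetminus y)\wedge(y\smallsetminus x)=0$ for all $x,y$; monotone means isotone in the first and antitone in the second variable; Cevian means $x\smallsetminus z\leq(x\smallsetminus y)\vee(y\smallsetminus z)$ for all $x,y,z$. $D$ is monotone-Cevian if it has a monotone Cevian deviation. *)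

theory Defs
  imports Main
begin

text \<open>An \<open>\<ell>\<close>-group is a group, not necessarily commutative although written additively, with a
  lattice order invariant under translations on both sides.\<close>

class lgroup = group_add + lattice +
  assumes lgroup_add_left_mono: "a \<le> b \<Longrightarrow> c + a \<le> c + b"
    and lgroup_add_right_mono: "a \<le> b \<Longrightarrow> a + c \<le> b + c"

definition labs :: "'a::lgroup \<Rightarrow> 'a" where
  "labs a = sup a (- a)"

primrec nmult :: "nat \<Rightarrow> 'a::monoid_add \<Rightarrow> 'a" where
  "nmult 0 a = 0"
| "nmult (Suc n) a = a + nmult n a"

definition convex_gen :: "'a::lgroup \<Rightarrow> 'a set" where
  "convex_gen a = {x. \<exists>n. - nmult n (labs a) \<le> x \<and> x \<le> nmult n (labs a)}"

lemma lgroup_add_mono: "a \<le> b \<Longrightarrow> c \<le> d \<Longrightarrow> a + c \<le> b + (d::'a::lgroup)"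
  by (meson lgroup_add_left_mono lgroup_add_right_mono order_trans)

lemma lgroup_le_neg: "a \<le> - b \<Longrightarrow> b \<le> - (a::'a::lgroup)"
proof -
  assume "a \<le> - b"
  then have "- a + a + b \<le> - a + (- b) + b"
    by (intro lgroup_add_right_mono lgroup_add_left_mono)
  then show ?thesis by (simp add: add.assoc)
qed

lemma lgroup_neg_le: "- a \<le> b \<Longrightarrow> - b \<le> (a::'a::lgroup)"
proof -
  assume "- a \<le> b"
  then have "a + - a + - b \<le> a + b + - b"
    by (intro lgroup_add_right_mono lgroup_add_left_mono)
  then show ?thesis by (simp add: add.assoc)
qed

lemma lgroup_add_inf_le:
  fixes a b c d e :: "'a::lgroup"
  assumes "e \<le> a + c" "e \<le> a + d" "e \<le> b + c" "e \<le> b + d"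
  shows "e \<le> inf a b + inf c d"
proof -
  have *: "e \<le> x + inf c d" if "e \<le> x + c" "e \<le> x + d" for x
  proof -
    have "- x + e \<le> - x + (x + c)" "- x + e \<le> - x + (x + d)"
      using that by (simp_all only: lgroup_add_left_mono)
    then have "- x + e \<le> inf c d" by simp
    then have "x + (- x + e) \<le> x + inf c d" by (rule lgroup_add_left_mono)
    then show ?thesis by (simp add: add.assoc[symmetric])
  qed
  let ?y = "inf c d"
  have "e + - ?y \<le> a + ?y + - ?y" "e + - ?y \<le> b + ?y + - ?y"
    using * assms by (simp_all only: lgroup_add_right_mono)
  then have "e + - ?y \<le> inf a b" by (simp add: add.assoc)
  then have "e + - ?y + ?y \<le> inf a b + ?y" by (rule lgroup_add_right_mono)
  then show ?thesis by (simp add: add.assoc)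
qed

lemma labs_nonneg: "0 \<le> labs (a::'a::lgroup)"
proof -
  let ?x = "labs a"
  have *: "0 \<le> ?x + ?x"
    using lgroup_add_mono[of a ?x "- a" ?x] by (simp add: labs_def)
  have "inf ?x 0 \<le> ?x + ?x" using * by (meson inf_le2 order_trans)
  then have "inf ?x 0 \<le> inf ?x 0 + inf ?x 0"
    by (intro lgroup_add_inf_le) auto
  then have "- inf ?x 0 + inf ?x 0 \<le> - inf ?x 0 + (inf ?x 0 + inf ?x 0)"
    by (rule lgroup_add_left_mono)
  then have "0 \<le> inf ?x 0" by (simp add: add.assoc[symmetric])
  then show ?thesis by simp
qed

lemma nmult_add: "nmult (m + n) a = nmult m a + nmult n a"
  by (induction m) (auto simp: add.assoc)

lemma nmult_nmult: "nmult m (nmult n a) = nmult (m * n) a"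
  by (induction m) (auto simp: nmult_add)

lemma nmult_nonneg: "0 \<le> a \<Longrightarrow> 0 \<le> nmult n (a::'a::lgroup)"
proof (induction n)
  case (Suc n)
  then show ?case using lgroup_add_mono[of 0 a 0 "nmult n a"] by simp
qed simp

lemma nmult_mono: "a \<le> b \<Longrightarrow> nmult n a \<le> nmult n (b::'a::lgroup)"
  by (induction n) (auto intro: lgroup_add_mono)

lemma nmult_mono_left:
  assumes "0 \<le> a" "m \<le> n"
  shows "nmult m a \<le> nmult n (a::'a::lgroup)"
proof -
  have "nmult n a = nmult m a + nmult (n - m) a"
    using assms by (simp add: nmult_add[symmetric])
  then show ?thesis
    using lgroup_add_left_mono[OF nmult_nonneg[OF assms(1)], of "nmult m a" "n - m"] by simp
qed

lemma labs_le_iff: "labs x \<le> (b::'a::lgroup) \<longleftrightarrow> - b \<le> x \<and> x \<le> b"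
  unfolding labs_def using lgroup_neg_le by auto

lemma labs_of_nonneg: "0 \<le> a \<Longrightarrow> labs a = (a::'a::lgroup)"
  unfolding labs_def using lgroup_neg_le[of 0 a] by (intro sup_absorb1) (auto intro: order_trans lgroup_neg_le)

lemma mem_convex_gen: "x \<in> convex_gen a \<longleftrightarrow> (\<exists>n. labs x \<le> nmult n (labs a))"
  unfolding convex_gen_def by (simp add: labs_le_iff)

lemma convex_gen_subset_iff:
  "convex_gen a \<subseteq> convex_gen b \<longleftrightarrow> (\<exists>n. labs a \<le> nmult n (labs b))"
proof
  have "labs a \<le> nmult 1 (labs a)" by simp
  then have "a \<in> convex_gen a" unfolding mem_convex_gen by blast
  then show "convex_gen a \<subseteq> convex_gen b \<Longrightarrow> \<exists>n. labs a \<le> nmult n (labs b)"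
    using mem_convex_gen by blast
next
  assume "\<exists>n. labs a \<le> nmult n (labs b)"
  then obtain n where n: "labs a \<le> nmult n (labs b)" by blast
  show "convex_gen a \<subseteq> convex_gen b"
  proof
    fix x assume "x \<in> convex_gen a"
    then obtain m where "labs x \<le> nmult m (labs a)" unfolding mem_convex_gen by blast
    also have "\<dots> \<le> nmult m (nmult n (labs b))" using n by (rule nmult_mono)
    finally show "x \<in> convex_gen b" unfolding mem_convex_gen nmult_nmult by blast
  qed
qed

lemma inf_nmult_le:
  fixes a b c :: "'a::lgroup"
  assumes "0 \<le> a" "0 \<le> b" "0 \<le> c" "c \<le> a" "c \<le> nmult n b"
  shows "c \<le> nmult n (inf a b)"
  using assms(3-5)
proof (induction n arbitrary: c)
  case (Suc n)
  let ?d = "inf c (nmult n b)"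
  have nb: "0 \<le> nmult n b" using assms(2) by (rule nmult_nonneg)
  have "?d \<le> nmult n (inf a b)"
    using Suc.prems nb by (intro Suc.IH) (auto intro: le_infI1)
  moreover have "c \<le> inf a b + ?d"
  proof (rule lgroup_add_inf_le)
    show "c \<le> a + c" using lgroup_add_right_mono[OF assms(1), of c] by simp
    show "c \<le> a + nmult n b" using lgroup_add_mono[OF Suc.prems(2) nb] by simp
    show "c \<le> b + c" using lgroup_add_right_mono[OF assms(2), of c] by simp
    show "c \<le> b + nmult n b" using Suc.prems(3) by simp
  qed
  ultimately show ?case
    using lgroup_add_left_mono order_trans by (metis nmult.simps(2))
qed simp

lemma convex_gen_inf: "convex_gen a \<inter> convex_gen b = convex_gen (inf (labs a) (labs b))"
proof -
  let ?c = "inf (labs a) (labs b)"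
  have c: "labs ?c = ?c" by (rule labs_of_nonneg) (simp add: labs_nonneg)
  have "x \<in> convex_gen ?c" if xa: "x \<in> convex_gen a" and xb: "x \<in> convex_gen b" for x
  proof -
    obtain m n where mn: "labs x \<le> nmult m (labs a)" "labs x \<le> nmult n (labs b)"
      using xa xb unfolding mem_convex_gen by blast
    have "labs x \<le> nmult n (inf (nmult m (labs a)) (labs b))"
      using mn by (intro inf_nmult_le) (auto simp: labs_nonneg nmult_nonneg)
    also have "\<dots> \<le> nmult n (nmult m ?c)"
    proof (rule nmult_mono)
      have "inf (labs b) (nmult m (labs a)) \<le> nmult m (inf (labs b) (labs a))"
        by (intro inf_nmult_le) (auto simp: labs_nonneg nmult_nonneg)
      then show "inf (nmult m (labs a)) (labs b) \<le> nmult m ?c" by (simp add: inf_commute)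
    qed
    finally show ?thesis unfolding mem_convex_gen nmult_nmult c by blast
  qed
  moreover have "convex_gen ?c \<subseteq> convex_gen a" "convex_gen ?c \<subseteq> convex_gen b"
    unfolding convex_gen_subset_iff c by (auto intro!: exI[of _ 1])
  ultimately show ?thesis by blast
qed

lemma convex_gen_sup_ub:
  "convex_gen a \<union> convex_gen b \<subseteq> convex_gen (sup (labs a) (labs b))"
proof -
  let ?c = "sup (labs a) (labs b)"
  have c: "labs ?c = ?c" by (rule labs_of_nonneg) (simp add: labs_nonneg le_supI1)
  have "convex_gen a \<subseteq> convex_gen ?c" "convex_gen b \<subseteq> convex_gen ?c"
    unfolding convex_gen_subset_iff c by (auto intro!: exI[of _ 1])
  then show ?thesis by blast
qed

lemma convex_gen_sup_least:
  assumes "convex_gen a \<union> convex_gen b \<subseteq> convex_gen c"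
  shows "convex_gen (sup (labs a) (labs b)) \<subseteq> convex_gen c"
proof -
  let ?d = "sup (labs a) (labs b)"
  have d: "labs ?d = ?d" by (rule labs_of_nonneg) (simp add: labs_nonneg le_supI1)
  obtain m n where mn: "labs a \<le> nmult m (labs c)" "labs b \<le> nmult n (labs c)"
    using assms convex_gen_subset_iff by (metis Un_subset_iff)
  have "nmult m (labs c) \<le> nmult (m + n) (labs c)" "nmult n (labs c) \<le> nmult (m + n) (labs c)"
    by (auto intro: nmult_mono_left labs_nonneg)
  with mn have "?d \<le> nmult (m + n) (labs c)" by (meson le_supI order_trans)
  then show ?thesis unfolding convex_gen_subset_iff d by blast
qed

typedef (overloaded) 'a csc = "range (convex_gen :: 'a::lgroup \<Rightarrow> 'a set)"
  by blast

text \<open>The order is inclusion, so the instance proof identifies \<open>inf\<close> and \<open>sup\<close> as the meet and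
  join of the poset of principal convex \<open>\<ell>\<close>-subgroups, whatever formulas define them.\<close>

instantiation csc :: (lgroup) lattice
begin

definition less_eq_csc :: "'a csc \<Rightarrow> 'a csc \<Rightarrow> bool" where
  "X \<le> Y \<longleftrightarrow> Rep_csc X \<subseteq> Rep_csc Y"

definition less_csc :: "'a csc \<Rightarrow> 'a csc \<Rightarrow> bool" where
  "X < Y \<longleftrightarrow> Rep_csc X \<subset> Rep_csc Y"

definition inf_csc :: "'a csc \<Rightarrow> 'a csc \<Rightarrow> 'a csc" where
  "inf X Y = Abs_csc (Rep_csc X \<inter> Rep_csc Y)"

definition sup_csc :: "'a csc \<Rightarrow> 'a csc \<Rightarrow> 'a csc" where
  "sup X Y = Abs_csc (\<Inter>{Z \<in> range convex_gen. Rep_csc X \<union> Rep_csc Y \<subseteq> Z})"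

instance
proof
  fix X Y Z :: "'a csc"
  obtain a where a: "Rep_csc X = convex_gen a" using Rep_csc[of X] by blast
  obtain b where b: "Rep_csc Y = convex_gen b" using Rep_csc[of Y] by blast
  have inf: "Rep_csc (inf X Y) = Rep_csc X \<inter> Rep_csc Y"
    unfolding inf_csc_def by (rule Abs_csc_inverse) (simp add: a b convex_gen_inf)
  have "\<Inter>{Z \<in> range convex_gen. Rep_csc X \<union> Rep_csc Y \<subseteq> Z} = convex_gen (sup (labs a) (labs b))"
    using convex_gen_sup_ub[of a b] convex_gen_sup_least[of a b] unfolding a b by blast
  then have sup: "Rep_csc (sup X Y) = convex_gen (sup (labs a) (labs b))"
    unfolding sup_csc_def by (simp add: Abs_csc_inverse)
  show "(X < Y) = (X \<le> Y \<and> \<not> Y \<le> X)" by (auto simp: less_csc_def less_eq_csc_def)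
  show "X \<le> X" by (simp add: less_eq_csc_def)
  show "X \<le> Y \<Longrightarrow> Y \<le> Z \<Longrightarrow> X \<le> Z" by (auto simp: less_eq_csc_def)
  show "X \<le> Y \<Longrightarrow> Y \<le> X \<Longrightarrow> X = Y" by (auto simp: less_eq_csc_def Rep_csc_inject[symmetric])
  show "inf X Y \<le> X" "inf X Y \<le> Y" by (auto simp: less_eq_csc_def inf)
  show "X \<le> sup X Y" "Y \<le> sup X Y"
    using convex_gen_sup_ub[of a b] by (auto simp: less_eq_csc_def sup a b)
  show "Y \<le> X \<Longrightarrow> Z \<le> X \<Longrightarrow> sup Y Z \<le> X"
  proof -
    assume *: "Y \<le> X" "Z \<le> X"
    obtain c where c: "Rep_csc Z = convex_gen c" using Rep_csc[of Z] by blast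
    have "\<Inter>{W \<in> range convex_gen. Rep_csc Y \<union> Rep_csc Z \<subseteq> W} = convex_gen (sup (labs b) (labs c))"
      using convex_gen_sup_ub[of b c] convex_gen_sup_least[of b c] unfolding b c by blast
    then have "Rep_csc (sup Y Z) = convex_gen (sup (labs b) (labs c))"
      unfolding sup_csc_def by (simp add: Abs_csc_inverse)
    then show ?thesis
      using * convex_gen_sup_least[of b c a] by (simp add: less_eq_csc_def a b c)
  qed
  show "X \<le> Y \<Longrightarrow> X \<le> Z \<Longrightarrow> X \<le> inf Y Z"
  proof -
    assume *: "X \<le> Y" "X \<le> Z"
    obtain c where c: "Rep_csc Z = convex_gen c" using Rep_csc[of Z] by blast
    have "Rep_csc (inf Y Z) = Rep_csc Y \<inter> Rep_csc Z"
      unfolding inf_csc_def by (rule Abs_csc_inverse) (simp add: b c convex_gen_inf)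
    then show ?thesis using * by (simp add: less_eq_csc_def)
  qed
qed

end

definition lattice_hom :: "('a::lattice \<Rightarrow> 'b::lattice) \<Rightarrow> bool" where
  "lattice_hom f \<longleftrightarrow>
    (\<forall>x y. f (sup x y) = sup (f x) (f y)) \<and> (\<forall>x y. f (inf x y) = inf (f x) (f y))"

definition finitely_separable :: "'a::order itself \<Rightarrow> bool" where
  "finitely_separable _ \<longleftrightarrow> (\<exists>A B :: 'a \<Rightarrow> 'a set.
    (\<forall>z. finite (A z) \<and> (\<forall>u \<in> A z. z \<le> u)) \<and>
    (\<forall>z. finite (B z) \<and> (\<forall>u \<in> B z. u \<le> z)) \<and>
    (\<forall>x y. x \<le> y \<longrightarrow> A x \<inter> B y \<noteq> {}))"

definition deviation :: "('a::{distrib_lattice, bounded_lattice_bot} \<Rightarrow> 'a \<Rightarrow> 'a) \<Rightarrow> bool" where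
  "deviation d \<longleftrightarrow>
    (\<forall>x y. x \<le> sup y (d x y)) \<and> (\<forall>x y. inf (d x y) (d y x) = bot)"

definition monotone_deviation ::
    "('a::{distrib_lattice, bounded_lattice_bot} \<Rightarrow> 'a \<Rightarrow> 'a) \<Rightarrow> bool" where
  "monotone_deviation d \<longleftrightarrow> deviation d \<and> (\<forall>y. mono (\<lambda>x. d x y)) \<and> (\<forall>x. antimono (d x))"

definition cevian_deviation ::
    "('a::{distrib_lattice, bounded_lattice_bot} \<Rightarrow> 'a \<Rightarrow> 'a) \<Rightarrow> bool" where
  "cevian_deviation d \<longleftrightarrow> deviation d \<and> (\<forall>x y z. d x z \<le> sup (d x y) (d y z))"

definition monotone_cevian :: "'a::{distrib_lattice, bounded_lattice_bot} itself \<Rightarrow> bool" where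
  "monotone_cevian _ \<longleftrightarrow>
    (\<exists>d :: 'a \<Rightarrow> 'a \<Rightarrow> 'a. monotone_deviation d \<and> cevian_deviation d)"

end

theory Submission
  imports Defs "HOL-Library.Countable_Set"
begin

text \<open>If \<open>\<gamma>\<close> picks for every \<open>x\<close> a positive generator of some principal convex
  \<open>\<ell>\<close>-subgroup in the fibre \<open>f\<inverse>(x)\<close>, then sending \<open>(x, y)\<close> to the image under \<open>f\<close> of
  \<open>\<langle>(\<gamma> x - \<gamma> y)\<^sup>+\<rangle>\<close> is a Cevian deviation, and it is monotone when \<open>\<gamma>\<close> is isotone.
  Finite separability makes an isotone \<open>\<gamma>\<close> available: if \<open>\<gamma>\<close> is defined on a set \<open>C\<close> closed
  under \<open>A\<close> and \<open>B\<close>, then the elements of \<open>C\<close> below \<open>x\<close> are dominated by those in the finite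
  set \<open>B x \<inter> C\<close>, and dually for \<open>A\<close>. So \<open>\<gamma>\<close> extends, one element at a time, to the countable
  closure of any further point under \<open>A\<close> and \<open>B\<close>, and Zorn's lemma applies.\<close>

section \<open>Isotone sections\<close>

text \<open>By antisymmetry an isotone relation is the graph of a partial function.\<close>

definition isotone_rel :: "('d::order \<times> 'l::order) set \<Rightarrow> bool" where
  "isotone_rel R \<longleftrightarrow> (\<forall>(x, a) \<in> R. \<forall>(y, b) \<in> R. x \<le> y \<longrightarrow> a \<le> b)"

lemma isotone_relD: "isotone_rel R \<Longrightarrow> (x, a) \<in> R \<Longrightarrow> (y, b) \<in> R \<Longrightarrow> x \<le> y \<Longrightarrow> a \<le> b"
  unfolding isotone_rel_def by blast

lemma isotone_rel_Union_chain:
  assumes "subset.chain \<A> \<C>" "\<And>R. R \<in> \<C> \<Longrightarrow> isotone_rel R"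
  shows "isotone_rel (\<Union>\<C>)"
  unfolding isotone_rel_def
proof (clarify)
  fix x a R y b S
  assume *: "(x, a) \<in> R" "R \<in> \<C>" "(y, b) \<in> S" "S \<in> \<C>" "x \<le> y"
  then have "R \<subseteq> S \<or> S \<subseteq> R" using assms(1) by (auto simp: subset_chain_def)
  with * assms(2) isotone_relD show "a \<le> b" by (metis subsetD)
qed

section \<open>Interpolation inside the fibres of a surjective lattice homomorphism\<close>

locale lattice_fibres =
  fixes P :: "'l::lattice set" and \<phi> :: "'l \<Rightarrow> 'd::lattice"
  assumes sup_closed: "a \<in> P \<Longrightarrow> b \<in> P \<Longrightarrow> sup a b \<in> P"
    and inf_closed: "a \<in> P \<Longrightarrow> b \<in> P \<Longrightarrow> inf a b \<in> P"
    and map_sup: "a \<in> P \<Longrightarrow> b \<in> P \<Longrightarrow> \<phi> (sup a b) = sup (\<phi> a) (\<phi> b)"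
    and map_inf: "a \<in> P \<Longrightarrow> b \<in> P \<Longrightarrow> \<phi> (inf a b) = inf (\<phi> a) (\<phi> b)"
    and onto: "\<exists>a \<in> P. \<phi> a = x"
begin

text \<open>Joining a point of the fibre over \<open>x\<close> with an \<open>l\<close> such that
  \<open>\<phi> l \<le> x\<close> does not leave the fibre.\<close>

lemma fibre_upper_bound:
  assumes "finite L" "\<forall>l \<in> L. l \<in> P \<and> \<phi> l \<le> x"
  shows "\<exists>s \<in> P. \<phi> s = x \<and> (\<forall>l \<in> L. l \<le> s)"
  using assms
proof (induction rule: finite_induct)
  case empty
  then show ?case using onto by auto
next
  case (insert l L)
  then obtain s where "s \<in> P" "\<phi> s = x" "\<forall>l \<in> L. l \<le> s" by auto
  with insert.prems show ?case
    by (intro bexI[of _ "sup s l"]) (auto simp: map_sup sup_closed sup_absorb1 le_supI1)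
qed

text \<open>Dually, meets with elements whose image is above \<open>x\<close> stay in the fibre. The
  last conjunct makes \<open>t\<close> the meet of \<open>s\<close> and all of \<open>U\<close>;
  through it the lower bounds met by \<open>s\<close> survive the cut in
  \<open>fibre_interpolation\<close>.\<close>

lemma fibre_infimum:
  assumes "finite U" "\<forall>u \<in> U. u \<in> P \<and> x \<le> \<phi> u" "s \<in> P" "\<phi> s = x"
  shows "\<exists>t \<in> P. \<phi> t = x \<and> (\<forall>u \<in> U. t \<le> u) \<and> (\<forall>b. b \<le> s \<and> (\<forall>u \<in> U. b \<le> u) \<longrightarrow> b \<le> t)"
  using assms(1,2)
proof (induction rule: finite_induct)
  case empty
  then show ?case using assms by auto
next
  case (insert u U)
  then obtain t where "t \<in> P" "\<phi> t = x" "\<forall>u \<in> U. t \<le> u"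
    "\<forall>b. b \<le> s \<and> (\<forall>u \<in> U. b \<le> u) \<longrightarrow> b \<le> t" by auto
  with insert.prems show ?case
    by (intro bexI[of _ "inf t u"]) (auto simp: map_inf inf_closed inf_absorb1 le_infI1)
qed

lemma fibre_interpolation:
  assumes "finite L" "\<forall>l \<in> L. l \<in> P \<and> \<phi> l \<le> x"
    and "finite U" "\<forall>u \<in> U. u \<in> P \<and> x \<le> \<phi> u"
    and "\<forall>l \<in> L. \<forall>u \<in> U. l \<le> u"
  shows "\<exists>a \<in> P. \<phi> a = x \<and> (\<forall>l \<in> L. l \<le> a) \<and> (\<forall>u \<in> U. a \<le> u)"
proof -
  obtain s where s: "s \<in> P" "\<phi> s = x" "\<forall>l \<in> L. l \<le> s"
    using fibre_upper_bound[OF assms(1,2)] by blast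
  then show ?thesis using fibre_infimum[OF assms(3,4) s(1,2)] assms(5) by meson
qed

section \<open>Extending isotone sections point by point\<close>

definition partial_section :: "('d \<times> 'l) set \<Rightarrow> bool" where
  "partial_section R \<longleftrightarrow> isotone_rel R \<and> (\<forall>(x, a) \<in> R. a \<in> P \<and> \<phi> a = x)"

lemma partial_sectionD:
  assumes "partial_section R"
  shows "isotone_rel R" "(x, a) \<in> R \<Longrightarrow> a \<in> P" "(x, a) \<in> R \<Longrightarrow> \<phi> a = x"
  using assms unfolding partial_section_def by auto

lemma partial_section_Union_chain:
  assumes "subset.chain \<A> \<C>" "\<And>R. R \<in> \<C> \<Longrightarrow> partial_section R"
  shows "partial_section (\<Union>\<C>)"
  using isotone_rel_Union_chain[OF assms(1)] assms(2) unfolding partial_section_def by blast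

text \<open>\<open>L\<close> is cofinal among the points of the domain below \<open>x\<close> and
  \<open>U\<close> is coinitial among those above, so finitely many bounds control the new value and
  fibre interpolation applies. If \<open>x\<close> is already in the domain, antisymmetry forces
  \<open>a\<close> to be its old value.\<close>

lemma partial_section_insert:
  assumes R: "partial_section R"
    and L: "finite L" "L \<subseteq> Domain R" "\<forall>u \<in> L. u \<le> x"
      "\<forall>y \<in> Domain R. y \<le> x \<longrightarrow> (\<exists>u \<in> L. y \<le> u)"
    and U: "finite U" "U \<subseteq> Domain R" "\<forall>u \<in> U. x \<le> u"
      "\<forall>y \<in> Domain R. x \<le> y \<longrightarrow> (\<exists>u \<in> U. u \<le> y)"
  shows "\<exists>a. partial_section (insert (x, a) R)"
proof -
  obtain g where g: "\<And>y. y \<in> Domain R \<Longrightarrow> (y, g y) \<in> R"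
    using bchoice[of "Domain R" "\<lambda>y a. (y, a) \<in> R"] by blast
  note D = partial_sectionD[OF R]
  have gL: "\<And>u. u \<in> L \<Longrightarrow> (u, g u) \<in> R" and gU: "\<And>u. u \<in> U \<Longrightarrow> (u, g u) \<in> R"
    using g subsetD[OF L(2)] subsetD[OF U(2)] by blast+
  have "\<exists>a \<in> P. \<phi> a = x \<and> (\<forall>l \<in> g ` L. l \<le> a) \<and> (\<forall>u \<in> g ` U. a \<le> u)"
  proof (rule fibre_interpolation)
    show "\<forall>l \<in> g ` L. l \<in> P \<and> \<phi> l \<le> x" using gL D(2,3) L(3) by fastforce
    show "\<forall>u \<in> g ` U. u \<in> P \<and> x \<le> \<phi> u" using gU D(2,3) U(3) by fastforce
    show "\<forall>l \<in> g ` L. \<forall>u \<in> g ` U. l \<le> u"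
    proof clarify
      fix l u assume "l \<in> L" "u \<in> U"
      moreover from this L(3) U(3) have "l \<le> u" by (meson order_trans)
      ultimately show "g l \<le> g u" using isotone_relD[OF D(1) gL gU] by blast
    qed
  qed (use L U in auto)
  then obtain a where a: "a \<in> P" "\<phi> a = x" "\<And>l. l \<in> L \<Longrightarrow> g l \<le> a" "\<And>u. u \<in> U \<Longrightarrow> a \<le> g u"
    by auto
  have "b \<le> a" if "(y, b) \<in> R" "y \<le> x" for y b
    using L(4) that a(3) isotone_relD[OF D(1) that(1) gL] by (meson DomainI order_trans)
  moreover have "a \<le> b" if "(y, b) \<in> R" "x \<le> y" for y b
    using U(4) that a(4) isotone_relD[OF D(1) gU that(1)] by (meson DomainI order_trans)
  ultimately have "isotone_rel (insert (x, a) R)"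
    using D(1) unfolding isotone_rel_def by auto
  then show ?thesis using R a unfolding partial_section_def by auto
qed

theorem isotone_section:
  assumes "finitely_separable TYPE('d)"
  shows "\<exists>\<gamma>. mono \<gamma> \<and> (\<forall>x. \<gamma> x \<in> P \<and> \<phi> (\<gamma> x) = x)"
proof -
  obtain A B :: "'d \<Rightarrow> 'd set"
    where A: "\<And>z. finite (A z)" "\<And>z u. u \<in> A z \<Longrightarrow> z \<le> u"
      and B: "\<And>z. finite (B z)" "\<And>z u. u \<in> B z \<Longrightarrow> u \<le> z"
      and AB: "\<And>x y. x \<le> y \<Longrightarrow> A x \<inter> B y \<noteq> {}"
    using assms unfolding finitely_separable_def by metis
  define closed where "closed X \<longleftrightarrow> (\<forall>x \<in> X. A x \<subseteq> X \<and> B x \<subseteq> X)" for X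
  let ?\<A> = "{R. partial_section R \<and> closed (Domain R)}"
  have "\<exists>M \<in> ?\<A>. \<forall>R \<in> ?\<A>. M \<subseteq> R \<longrightarrow> R = M"
  proof (rule subset_Zorn')
    fix \<C> assume \<C>: "subset.chain ?\<A> \<C>"
    then have sub: "\<C> \<subseteq> ?\<A>" by (simp add: subset_chain_def)
    then have "\<And>R. R \<in> \<C> \<Longrightarrow> closed (Domain R)" by blast
    then have "closed (\<Union>R \<in> \<C>. Domain R)"
      unfolding closed_def by (meson UN_E UN_upper order_trans)
    moreover have "partial_section (\<Union>\<C>)"
      using partial_section_Union_chain[OF \<C>] sub by blast
    ultimately show "\<Union>\<C> \<in> ?\<A>" by (simp add: Domain_Union)
  qed
  then obtain M where M: "partial_section M" "closed (Domain M)"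
    and maximal: "\<And>R. partial_section R \<Longrightarrow> closed (Domain R) \<Longrightarrow> M \<subseteq> R \<Longrightarrow> R = M" by blast
  have step: "\<exists>G. (partial_section (M \<union> G) \<and> finite G) \<and> F \<subseteq> G \<and> Domain G = insert x (Domain F)"
    if F: "partial_section (M \<union> F)" "finite F" for F x
  proof -
    \<comment> \<open>Only \<open>Domain M\<close> is known to be closed. The points of
      \<open>F\<close> are not controlled by \<open>A\<close> and \<open>B\<close>, but they are
      finite in number and can serve as their own bounds.\<close>
    let ?L = "{u \<in> Domain (M \<union> F). u \<le> x \<and> u \<in> B x \<union> Domain F}"
    let ?U = "{u \<in> Domain (M \<union> F). x \<le> u \<and> u \<in> A x \<union> Domain F}"
    have "\<exists>u \<in> ?L. y \<le> u" if "y \<in> Domain (M \<union> F)" "y \<le> x" for y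
    proof (cases "y \<in> Domain F")
      case False
      with that have "A y \<subseteq> Domain M" using M(2) by (auto simp: closed_def)
      then show ?thesis using AB[OF that(2)] A(2) B(2) by fastforce
    qed (use that in blast)
    moreover have "\<exists>u \<in> ?U. u \<le> y" if "y \<in> Domain (M \<union> F)" "x \<le> y" for y
    proof (cases "y \<in> Domain F")
      case False
      with that have "B y \<subseteq> Domain M" using M(2) by (auto simp: closed_def)
      then show ?thesis using AB[OF that(2)] A(2) B(2) by fastforce
    qed (use that in blast)
    moreover have "finite ?L" "finite ?U"
      using F(2) A(1) B(1) by (auto intro: rev_finite_subset[of "B x \<union> Domain F"]
        rev_finite_subset[of "A x \<union> Domain F"] finite_Domain)
    ultimately obtain a where "partial_section (insert (x, a) (M \<union> F))"
      using partial_section_insert[OF F(1), of ?L x ?U] by blast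
    then show ?thesis using F(2) by (intro exI[of _ "insert (x, a) F"]) auto
  qed
  have total: "x \<in> Domain M" for x
  proof -
    \<comment> \<open>The closure of \<open>x\<close> under \<open>A\<close> and \<open>B\<close>;
      it is countable because each step adds finitely many points.\<close>
    define X where "X = {(y, z). z \<in> A y \<union> B y}\<^sup>* `` {x}"
    have X: "x \<in> X" "closed X"
      unfolding X_def closed_def by (auto intro: rtrancl_into_rtrancl)
    have "countable X"
      unfolding X_def
    proof (rule countable_rtrancl)
      fix Y :: "'d set" assume "countable Y"
      moreover have "{(y, z). z \<in> A y \<union> B y} `` Y = (\<Union>y \<in> Y. A y \<union> B y)" by auto
      ultimately show "countable ({(y, z). z \<in> A y \<union> B y} `` Y)"
        using A(1) B(1) by (simp add: uncountable_infinite countable_finite)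
    qed simp
    with X(1) have e: "range (from_nat_into X) = X" by (intro range_from_nat_into) auto
    \<comment> \<open>The domains of the stages need not be closed. Each stage only has to be finite
      over \<open>M\<close>; closure returns in the union, whose domain is
      \<open>Domain M \<union> X\<close>.\<close>
    let ?Q = "\<lambda>(n::nat) F. (partial_section (M \<union> F) \<and> finite F) \<and> Domain F \<subseteq> X"
    have "\<exists>F. \<forall>n. ?Q n (F n) \<and> F n \<subseteq> F (Suc n) \<and> from_nat_into X n \<in> Domain (F (Suc n))"
    proof (rule dependent_nat_choice)
      show "\<exists>F. ?Q 0 F" using M(1) by (intro exI[of _ "{}"]) simp
      show "\<exists>G. ?Q (Suc n) G \<and> F \<subseteq> G \<and> from_nat_into X n \<in> Domain G" if "?Q n F" for F n
      proof -
        obtain G where "partial_section (M \<union> G)" "finite G" "F \<subseteq> G"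
          "Domain G = insert (from_nat_into X n) (Domain F)"
          using step[of F "from_nat_into X n"] \<open>?Q n F\<close> by blast
        moreover have "from_nat_into X n \<in> X" using e by blast
        ultimately show ?thesis using \<open>?Q n F\<close> by (intro exI[of _ G]) simp
      qed
    qed
    then obtain F where F: "\<And>n. partial_section (M \<union> F n)" "\<And>n. F n \<subseteq> F (Suc n)" "\<And>n. Domain (F n) \<subseteq> X"
        "\<And>n. from_nat_into X n \<in> Domain (F (Suc n))"
      by blast
    define N where "N = (\<Union>n. M \<union> F n)"
    have "F m \<subseteq> F n \<or> F n \<subseteq> F m" for m n
      using lift_Suc_mono_le[of F, OF F(2)] by (meson nat_le_linear)
    then have "subset.chain UNIV (range (\<lambda>n. M \<union> F n))"
      unfolding subset_chain_def by blast
    then have "partial_section N"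
      unfolding N_def by (rule partial_section_Union_chain) (use F(1) in blast)
    moreover have dom: "Domain N = Domain M \<union> X"
    proof
      show "Domain N \<subseteq> Domain M \<union> X" using F(3) by (auto simp: N_def)
      have "range (from_nat_into X) \<subseteq> (\<Union>n. Domain (F (Suc n)))" using F(4) by auto
      also have "\<dots> \<subseteq> Domain N" unfolding N_def by blast
      finally have "X \<subseteq> Domain N" unfolding e .
      moreover have "Domain M \<subseteq> Domain N" unfolding N_def by blast
      ultimately show "Domain M \<union> X \<subseteq> Domain N" by blast
    qed
    moreover have "closed (Domain N)" using M(2) X(2) unfolding dom closed_def by blast
    ultimately have "N = M" by (intro maximal) (auto simp: N_def)
    with X(1) dom show ?thesis by blast
  qed
  then obtain \<gamma> where \<gamma>: "\<And>x. (x, \<gamma> x) \<in> M"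
    using choice[of "\<lambda>x a. (x, a) \<in> M"] by blast
  then have "mono \<gamma>" using partial_sectionD(1)[OF M(1)] by (meson isotone_relD monoI)
  with \<gamma> show ?thesis using partial_sectionD[OF M(1)] by blast
qed

end

section \<open>Positive generators\<close>

definition csc_gen :: "'a::lgroup \<Rightarrow> 'a csc" where
  "csc_gen a = Abs_csc (convex_gen a)"

lemma Rep_csc_gen: "Rep_csc (csc_gen a) = convex_gen a"
  unfolding csc_gen_def by (simp add: Abs_csc_inverse)

lemma csc_gen_le_iff: "csc_gen a \<le> csc_gen b \<longleftrightarrow> (\<exists>n. labs a \<le> nmult n (labs b))"
  by (simp add: less_eq_csc_def Rep_csc_gen convex_gen_subset_iff)

lemma csc_gen_leI: "0 \<le> a \<Longrightarrow> 0 \<le> b \<Longrightarrow> a \<le> nmult n b \<Longrightarrow> csc_gen a \<le> csc_gen b"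
  unfolding csc_gen_le_iff by (auto simp: labs_of_nonneg)

lemma csc_gen_mono: "0 \<le> a \<Longrightarrow> a \<le> b \<Longrightarrow> csc_gen a \<le> csc_gen b"
  by (rule csc_gen_leI[where n = 1]) auto

lemma csc_gen_inf: "0 \<le> a \<Longrightarrow> 0 \<le> b \<Longrightarrow> csc_gen (inf a b) = inf (csc_gen a) (csc_gen b)"
  by (simp add: inf_csc_def Rep_csc_gen convex_gen_inf labs_of_nonneg) (simp add: csc_gen_def)

lemma csc_gen_nonneg_onto: "\<exists>a \<ge> 0. csc_gen a = X"
proof -
  obtain a where "Rep_csc X = convex_gen a" using Rep_csc[of X] by blast
  then have "X = csc_gen a" by (simp add: Rep_csc_gen flip: Rep_csc_inject)
  also have "csc_gen a = csc_gen (labs a)"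
    by (intro antisym) (auto simp: csc_gen_le_iff labs_of_nonneg labs_nonneg intro!: exI[of _ 1])
  finally show ?thesis using labs_nonneg by blast
qed

lemma csc_gen_sup:
  assumes "0 \<le> a" "0 \<le> b"
  shows "csc_gen (sup a b) = sup (csc_gen a) (csc_gen b)"
proof (rule antisym)
  obtain c where c: "csc_gen c = sup (csc_gen a) (csc_gen b)" using csc_gen_nonneg_onto by blast
  then have "csc_gen a \<le> csc_gen c" "csc_gen b \<le> csc_gen c" by simp_all
  then have "csc_gen (sup a b) \<le> csc_gen c"
    using convex_gen_sup_least[of a b c] assms
    by (simp add: less_eq_csc_def Rep_csc_gen labs_of_nonneg)
  with c show "csc_gen (sup a b) \<le> sup (csc_gen a) (csc_gen b)" by simp
  show "sup (csc_gen a) (csc_gen b) \<le> csc_gen (sup a b)"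
    using assms by (simp add: csc_gen_mono)
qed

section \<open>Truncated differences\<close>

text \<open>The positive part of \<open>a - b\<close>. The order of the summands in the lemmas below
  matters, as the group need not be commutative.\<close>

definition tdiff :: "'a::lgroup \<Rightarrow> 'a \<Rightarrow> 'a" where
  "tdiff a b = sup (a - b) 0"

lemma tdiff_nonneg [simp]: "0 \<le> tdiff a b"
  by (simp add: tdiff_def)

lemma tdiff_ge: "a - b \<le> tdiff a b"
  by (simp add: tdiff_def)

lemma lgroup_neg_mono: "a \<le> b \<Longrightarrow> - b \<le> - (a::'a::lgroup)"
  using lgroup_neg_le[of "- a" b] lgroup_le_neg[of a "- b"] by simp

lemma lgroup_diff_mono: "a \<le> a' \<Longrightarrow> b' \<le> b \<Longrightarrow> a - b \<le> a' - (b'::'a::lgroup)"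
  using lgroup_add_mono[of a a' "- b" "- b'"] lgroup_neg_mono[of b' b] by simp

lemma tdiff_mono: "a \<le> a' \<Longrightarrow> b' \<le> b \<Longrightarrow> tdiff a b \<le> tdiff a' b'"
  unfolding tdiff_def by (meson lgroup_diff_mono order_refl sup_mono)

lemma le_tdiff_add: "a \<le> tdiff a b + b"
  using lgroup_add_right_mono[OF tdiff_ge, of a b b] by simp

lemma tdiff_triangle: "tdiff a c \<le> tdiff a b + tdiff b c"
proof -
  have "a - b + (b - c) = a - c" by (simp add: add_diff_eq)
  then show ?thesis
    using lgroup_add_mono[OF tdiff_ge tdiff_ge, of a b b c]
      lgroup_add_mono[of 0 "tdiff a b" 0 "tdiff b c"]
    unfolding tdiff_def[of a c] by simp
qed

text \<open>These are the positive and negative parts of \<open>t = a - b\<close>. Their meet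
  \<open>e\<close> is at most \<open>t + q\<close>, so subtracting \<open>e\<close> from
  \<open>q\<close> leaves an upper bound of both \<open>- t\<close> and \<open>0\<close>; hence
  \<open>q \<le> q - e\<close>.\<close>

lemma tdiff_disjoint: "inf (tdiff a b) (tdiff b a) = 0"
proof (rule antisym)
  define t where "t = a - b"
  define q where "q = sup (- t) 0"
  define e where "e = inf (sup t 0) q"
  have "- t \<le> q" "0 \<le> q" by (simp_all add: q_def)
  then have "0 \<le> t + q" "t \<le> t + q"
    using lgroup_add_left_mono[of "- t" q t] lgroup_add_left_mono[of 0 q t] by simp_all
  then have "e \<le> t + q" unfolding e_def by (simp add: le_infI1)
  then have "e - q \<le> t" using lgroup_diff_mono[of e "t + q" q q] by simp
  then have 1: "- t \<le> q - e" using lgroup_neg_mono[of "e - q" t] by simp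
  have "e \<le> q" by (simp add: e_def)
  then have "0 \<le> q - e" using lgroup_diff_mono[of e q e e] by simp
  with 1 have "q \<le> q - e" unfolding q_def by simp
  then have "- q + q \<le> - q + (q - e)" by (rule lgroup_add_left_mono)
  then have "0 \<le> - e" by (simp add: add_diff_eq)
  then have "e \<le> 0" using lgroup_le_neg[of 0 e] by simp
  then show "inf (tdiff a b) (tdiff b a) \<le> 0" by (simp add: tdiff_def e_def q_def t_def)
qed simp

text \<open>A sum of positive elements is at most twice their join, so it generates nothing beyond
  the join.\<close>

lemma csc_gen_le_supI:
  assumes "0 \<le> a" "0 \<le> b" "0 \<le> c" "a \<le> b + c"
  shows "csc_gen a \<le> sup (csc_gen b) (csc_gen c)"
proof -
  have "b + c \<le> nmult 2 (sup b c)"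
    using lgroup_add_mono[of b "sup b c" c "sup b c"] by (simp add: numeral_2_eq_2)
  then show ?thesis
    using assms csc_gen_leI[of a "sup b c" 2] by (simp flip: csc_gen_sup) (meson le_supI1 order_trans)
qed

section \<open>The monotone Cevian deviation\<close>

theorem theorem5p1:
  fixes f :: "'g::lgroup csc \<Rightarrow> 'd::{distrib_lattice, bounded_lattice_bot}"
  assumes "lattice_hom f"
    and "surj f"
    and "finitely_separable TYPE('d)"
  shows "monotone_cevian TYPE('d)"
proof -
  have f_sup: "f (sup X Y) = sup (f X) (f Y)" and f_inf: "f (inf X Y) = inf (f X) (f Y)" for X Y
    using assms(1) by (auto simp: lattice_hom_def)
  have f_mono: "X \<le> Y \<Longrightarrow> f X \<le> f Y" for X Y
    using f_sup[of X Y] by (metis sup.absorb_iff2)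
  have f_onto: "\<exists>a \<ge> 0. f (csc_gen a) = x" for x
    using assms(2) csc_gen_nonneg_onto by (metis surjD)
  \<comment> \<open>Preservation of the least element comes from surjectivity:
    \<open>csc_gen 0\<close> lies below a preimage of \<open>bot\<close>.\<close>
  have f_0: "f (csc_gen 0) = bot"
    using f_onto[of bot] f_mono csc_gen_mono by (metis bot.extremum_uniqueI order_refl)
  \<comment> \<open>The carrier is the positive cone because \<open>csc_gen\<close> need not
    preserve joins and meets of arbitrary group elements.\<close>
  interpret lattice_fibres "{0..}" "\<lambda>a. f (csc_gen a)"
    using f_onto by unfold_locales
      (auto simp: csc_gen_sup csc_gen_inf f_sup f_inf le_supI1)
  obtain \<gamma> :: "'d \<Rightarrow> 'g" where \<gamma>: "mono \<gamma>" "\<And>x. 0 \<le> \<gamma> x" "\<And>x. f (csc_gen (\<gamma> x)) = x"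
    using isotone_section[OF assms(3)] by auto
  define d where "d x y = f (csc_gen (tdiff (\<gamma> x) (\<gamma> y)))" for x y
  have "x \<le> sup y (d x y)" for x y
    using f_mono[OF csc_gen_le_supI[OF \<gamma>(2) _ \<gamma>(2) le_tdiff_add], of x y]
    by (simp add: d_def f_sup \<gamma>(3) sup_commute)
  moreover have "inf (d x y) (d y x) = bot" for x y
    by (simp add: d_def f_0 tdiff_disjoint flip: f_inf csc_gen_inf)
  moreover have "d x z \<le> sup (d x y) (d y z)" for x y z
    using f_mono[OF csc_gen_le_supI[OF _ _ _ tdiff_triangle]] by (simp add: d_def f_sup)
  moreover have "d x y \<le> d x' y'" if "x \<le> x'" "y' \<le> y" for x x' y y'
    unfolding d_def using that \<gamma>(1) by (intro f_mono csc_gen_mono tdiff_mono) (auto simp: mono_def)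
  ultimately have "monotone_deviation d \<and> cevian_deviation d"
    by (auto simp: monotone_deviation_def cevian_deviation_def deviation_def mono_def monotone_def)
  then show ?thesis unfolding monotone_cevian_def by blast
qed

end
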